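(* Let $C\subseteq\mathbb{Z}_2^n$ be a $10$-cap of dimension $7$ that has a basis of extended type $7\text{-}5\text{-}(4)$. Then $C$ has a basis of extended type $5\text{-}5\text{-}(2)$.
   Context: Work in $\mathbb{Z}_2^n$. An affine combination of a set is a sum of an odd number of its distinct elements; $\operatorname{aff}(S)$ is the set of all affine combinations of elements of $S$, and the dimension of $S$ is the dimension of the affine flat $\operatorname{aff}(S)$. A basis for $S$ is a subset $B\subseteq S$ that is affinely independent (no element is an affine combination of the others) with $\operatorname{aff}(B)=\operatorname{aff}(S)$; its dependent set is $D=S\setminus B$. For $x\in D$, $B_x$ is the unique subset of $B$ whose elements sum to $x$. A quad is a set of four distinct elements summing to $\mathbf{0}$; a cap is a quad-free subset; a $k$-cap is a cap with $k$ elements. For $D=\{x_1,x_2\}$, a basis $B$ has extended type $n_1\text{-}n_2\text{-}(m)$ if the elements of $D$ can be labeled $x_1,x_2$ so that $|B_{x_1}|=n_1$, $|B_{x_2}|=n_2$ and $|B_{x_1}\cap B_{x_2}|=m$. *)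

theory Defs
  imports "HOL-Analysis.Analysis" "HOL-Library.Z2"
begin

text \<open>The ambient space \<open>\<int>\<^sub>2\<^sup>n\<close> is \<open>bit ^ 'n\<close> with \<open>n = CARD('n)\<close>.\<close>

definition aff :: "(bit ^ 'n) set \<Rightarrow> (bit ^ 'n) set" where
  "aff S = {x. \<exists>T. T \<subseteq> S \<and> odd (card T) \<and> x = \<Sum>T}"

text \<open>The dimension of an affine flat \<open>a + V\<close> is that of the linear space \<open>V\<close>, which is the set
  of all differences of points of the flat.\<close>

definition flat_dim :: "(bit ^ 'n) set \<Rightarrow> nat" where
  "flat_dim F = vec.dim {x - y | x y. x \<in> F \<and> y \<in> F}"

definition affine_dimension :: "(bit ^ 'n) set \<Rightarrow> nat" where
  "affine_dimension S = flat_dim (aff S)"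

definition aff_independent :: "(bit ^ 'n) set \<Rightarrow> bool" where
  "aff_independent B \<longleftrightarrow> (\<forall>x\<in>B. x \<notin> aff (B - {x}))"

definition is_basis :: "(bit ^ 'n) set \<Rightarrow> (bit ^ 'n) set \<Rightarrow> bool" where
  "is_basis B S \<longleftrightarrow> B \<subseteq> S \<and> aff_independent B \<and> aff B = aff S"

text \<open>\<open>basis_rep B x\<close> is the set written \<open>B\<^sub>x\<close>. Its elements form an affine combination, so their
  number is odd; without this requirement the subset would not be unique, as an affinely
  independent set may be linearly dependent (it may contain \<open>0\<close>, for instance).\<close>

definition basis_rep :: "(bit ^ 'n) set \<Rightarrow> bit ^ 'n \<Rightarrow> (bit ^ 'n) set" where
  "basis_rep B x = (THE T. T \<subseteq> B \<and> odd (card T) \<and> \<Sum>T = x)"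

definition is_quad :: "(bit ^ 'n) set \<Rightarrow> bool" where
  "is_quad Q \<longleftrightarrow> card Q = 4 \<and> \<Sum>Q = 0"

definition is_cap :: "(bit ^ 'n) set \<Rightarrow> bool" where
  "is_cap C \<longleftrightarrow> \<not> (\<exists>Q. Q \<subseteq> C \<and> is_quad Q)"

definition k_cap :: "nat \<Rightarrow> (bit ^ 'n) set \<Rightarrow> bool" where
  "k_cap k C \<longleftrightarrow> is_cap C \<and> card C = k"

definition has_extended_type ::
    "(bit ^ 'n) set \<Rightarrow> (bit ^ 'n) set \<Rightarrow> nat \<Rightarrow> nat \<Rightarrow> nat \<Rightarrow> bool" where
  "has_extended_type S B n1 n2 m \<longleftrightarrow>
     (\<exists>x1 x2. x1 \<noteq> x2 \<and> S - B = {x1, x2} \<and>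
        card (basis_rep B x1) = n1 \<and> card (basis_rep B x2) = n2 \<and>
        card (basis_rep B x1 \<inter> basis_rep B x2) = m)"

lemma bitvec_add_self: "x + x = (0 :: bit ^ 'n)"
  by (simp add: vec_eq_iff)

lemma ex1_basis_rep:
  fixes B :: "(bit ^ 'n) set"
  assumes ind: "aff_independent B" and x: "x \<in> aff B"
  shows "\<exists>!T. T \<subseteq> B \<and> odd (card T) \<and> \<Sum>T = x"
proof -
  have "T = U" if T: "T \<subseteq> B" "odd (card T)" "\<Sum>T = x"
    and U: "U \<subseteq> B" "odd (card U)" "\<Sum>U = x" for T U
  proof (rule ccontr)
    assume ne: "T \<noteq> U"
    have fin: "finite T" "finite U" "finite (T - U)" "finite (U - T)" "finite (T \<inter> U)"
      using T(2) U(2) by (auto intro: card_ge_0_finite odd_pos)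
    define D where "D = (T - U) \<union> (U - T)"
    have finD: "finite D" using fin by (simp add: D_def)
    have split: "\<Sum>T = \<Sum>(T - U) + \<Sum>(T \<inter> U)" "\<Sum>U = \<Sum>(U - T) + \<Sum>(T \<inter> U)"
      using sum.Int_Diff[OF fin(1), of "\<lambda>x. x" U] sum.Int_Diff[OF fin(2), of "\<lambda>x. x" T]
      by (simp_all add: Int_commute add.commute)
    have cards: "card T = card (T - U) + card (T \<inter> U)" "card U = card (U - T) + card (T \<inter> U)"
      using card_Diff_subset_Int[of T U] card_Diff_subset_Int[of U T] fin
        card_mono[of T "T \<inter> U"] card_mono[of U "T \<inter> U"]
      by (auto simp: Int_commute)
    have "\<Sum>D = \<Sum>(T - U) + \<Sum>(U - T)"
      unfolding D_def using fin by (intro sum.union_disjoint) auto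
    also have "\<dots> = 0" using split T(3) U(3) by (simp add: bitvec_add_self)
    finally have D0: "\<Sum>D = 0" .
    have "card D = card (T - U) + card (U - T)"
      unfolding D_def using fin by (intro card_Un_disjoint) auto
    then have evD: "even (card D)"
      using cards T(2) U(2) by presburger
    obtain d where d: "d \<in> D" using ne by (auto simp: D_def)
    have "d + \<Sum>(D - {d}) = 0" using D0 finD d by (simp add: sum.remove)
    then have "d = \<Sum>(D - {d})"
      by (metis add_left_cancel bitvec_add_self)
    moreover have "odd (card (D - {d}))"
      using evD d finD by (auto simp: card_gt_0_iff)
    moreover have "D - {d} \<subseteq> B - {d}" "d \<in> B" using T(1) U(1) d by (auto simp: D_def)
    ultimately show False using ind unfolding aff_independent_def aff_def by blast
  qed
  then show ?thesis using x unfolding aff_def by blast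
qed

end

theory Submission
  imports Defs
begin

text \<open>Call an even set with zero sum a dependency. Write \<open>I = B\<^sub>x\<^sub>1 \<inter> B\<^sub>x\<^sub>2\<close>, \<open>P = B\<^sub>x\<^sub>1 - I\<close> and
  \<open>B\<^sub>x\<^sub>2 = I \<union> {q}\<close>. The dependencies \<open>B\<^sub>x\<^sub>1 \<union> {x\<^sub>1}\<close> and \<open>B\<^sub>x\<^sub>2 \<union> {x\<^sub>2}\<close> add up to a third one,
  \<open>P \<union> {q, x\<^sub>1, x\<^sub>2}\<close>, which has six elements and meets \<open>B\<^sub>x\<^sub>2 \<union> {x\<^sub>2}\<close> in \<open>{q, x\<^sub>2}\<close>. So exchanging
  any \<open>i \<in> I\<close> for \<open>x\<^sub>2\<close> yields a basis of type \<open>5-5-(2)\<close>.\<close>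

lemma bitvec_add_eq_0_iff: "x + y = 0 \<longleftrightarrow> x = (y :: bit ^ 'n)"
  by (metis add_right_cancel bitvec_add_self)

text \<open>The elements of \<open>T \<inter> U\<close> occur twice on the right and cancel in
  characteristic 2.\<close>

lemma sum_sym_diff:
  fixes T U :: "(bit ^ 'n) set"
  assumes "finite T" "finite U"
  shows "\<Sum>(sym_diff T U) = \<Sum>T + \<Sum>U"
proof -
  have "\<Sum>T = \<Sum>(T \<inter> U) + \<Sum>(T - U)" "\<Sum>U = \<Sum>(T \<inter> U) + \<Sum>(U - T)"
    using sum.Int_Diff[OF assms(1), of "\<lambda>x. x" U] sum.Int_Diff[OF assms(2), of "\<lambda>x. x" T]
    by (simp_all add: Int_commute)
  moreover have "\<Sum>(sym_diff T U) = \<Sum>(T - U) + \<Sum>(U - T)"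
    using assms by (intro sum.union_disjoint) auto
  moreover have "(a + b) + (a + c) = b + c" for a b c :: "bit ^ 'n"
  proof -
    have "(a + b) + (a + c) = (a + a) + (b + c)" by (simp only: ac_simps)
    then show ?thesis by (simp add: bitvec_add_self)
  qed
  ultimately show ?thesis by simp
qed

lemma even_card_sym_diff:
  assumes "finite T" "finite U"
  shows "even (card (sym_diff T U)) \<longleftrightarrow> even (card T + card U)"
proof -
  have "card (sym_diff T U) = card (T - U) + card (U - T)"
    using assms by (intro card_Un_disjoint) auto
  moreover have "card T = card (T \<inter> U) + card (T - U)" "card U = card (T \<inter> U) + card (U - T)"
    using sum.Int_Diff[OF assms(1), of "\<lambda>_. 1::nat" U] sum.Int_Diff[OF assms(2), of "\<lambda>_. 1::nat" T]
    by (simp_all add: Int_commute)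
  ultimately show ?thesis by (simp, blast)
qed

text \<open>With coefficients 0 and 1 an affine dependency is determined by its support, and even
  cardinality says that the coefficients sum to zero.\<close>

definition dependency :: "(bit ^ 'n) set \<Rightarrow> bool" where
  "dependency E \<longleftrightarrow> finite E \<and> even (card E) \<and> \<Sum>E = 0"

text \<open>Symmetric difference is the addition of coefficient vectors over the two-element
  field.\<close>

lemma dependency_sym_diff:
  assumes "dependency E" "dependency F"
  shows "dependency (sym_diff E F)"
  using assms sum_sym_diff[of E F] even_card_sym_diff[of E F] by (simp add: dependency_def)

text \<open>This is the dictionary between affine combinations and dependencies: since
  \<open>x + x = 0\<close>, moving \<open>x\<close> across the equation flips the parity and leaves
  a zero sum.\<close>

lemma dependency_insert_iff:
  assumes "finite T" "x \<notin> T"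
  shows "dependency (insert x T) \<longleftrightarrow> odd (card T) \<and> \<Sum>T = x"
  using assms by (auto simp: dependency_def bitvec_add_eq_0_iff)

text \<open>A nonempty dependency can be solved for any of its elements, and conversely an element
  that depends on the others completes their combination to a dependency.\<close>

lemma aff_independent_iff_dependency:
  assumes "finite B"
  shows "aff_independent B \<longleftrightarrow> (\<forall>E \<subseteq> B. dependency E \<longrightarrow> E = {})"
proof
  assume ind: "aff_independent B"
  show "\<forall>E \<subseteq> B. dependency E \<longrightarrow> E = {}"
  proof (intro allI impI, rule ccontr)
    fix E assume E: "E \<subseteq> B" "dependency E" "E \<noteq> {}"
    then obtain x where x: "x \<in> E" by blast
    have "odd (card (E - {x})) \<and> \<Sum>(E - {x}) = x"
      using dependency_insert_iff[of "E - {x}" x] E x by (simp add: dependency_def insert_absorb)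
    moreover have "E - {x} \<subseteq> B - {x}" using E(1) by blast
    ultimately have "x \<in> aff (B - {x})"
      unfolding aff_def by (intro CollectI exI[of _ "E - {x}"]) simp
    then show False using ind E(1) x by (auto simp: aff_independent_def)
  qed
next
  assume none: "\<forall>E \<subseteq> B. dependency E \<longrightarrow> E = {}"
  show "aff_independent B"
    unfolding aff_independent_def
  proof (intro ballI notI)
    fix x assume x: "x \<in> B" "x \<in> aff (B - {x})"
    then obtain T where T: "T \<subseteq> B - {x}" "odd (card T)" "x = \<Sum>T"
      unfolding aff_def by blast
    have "finite T" using T(1) assms by (auto intro: finite_subset)
    moreover have "x \<notin> T" using T(1) by blast
    ultimately have "dependency (insert x T)"
      using dependency_insert_iff T(2) T(3)[symmetric] by blast
    then show False using none T(1) x(1) by blast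
  qed
qed

text \<open>A combination that uses \<open>i\<close> can be rewritten without it by adding
  \<open>E\<close>: this cancels \<open>i\<close>, keeps the sum because \<open>E\<close> sums to 0,
  and keeps the parity because \<open>E\<close> is even.\<close>

lemma aff_remove_dependent:
  assumes E: "dependency E" "E \<subseteq> S" "i \<in> E"
  shows "aff (S - {i}) = aff S"
proof
  show "aff (S - {i}) \<subseteq> aff S" unfolding aff_def by blast
  show "aff S \<subseteq> aff (S - {i})"
  proof
    fix x assume "x \<in> aff S"
    then obtain T where T: "T \<subseteq> S" "odd (card T)" "x = \<Sum>T" unfolding aff_def by blast
    have fin: "finite T" using T(2) by (auto intro: card_ge_0_finite odd_pos)
    show "x \<in> aff (S - {i})"
    proof (cases "i \<in> T")
      case True
      have "sym_diff T E \<subseteq> S - {i}" "odd (card (sym_diff T E))" "x = \<Sum>(sym_diff T E)"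
        using True T E fin sum_sym_diff[of T E] even_card_sym_diff[of T E]
        by (auto simp: dependency_def)
      then show ?thesis unfolding aff_def by blast
    next
      case False
      then show ?thesis using T unfolding aff_def by blast
    qed
  qed
qed

text \<open>Adding \<open>insert x T\<close> to a dependency \<open>E\<close> of the new set that
  contains \<open>x\<close> cancels \<open>x\<close> and leaves a dependency inside
  \<open>B\<close>, hence the empty set. Then \<open>E\<close> equals \<open>insert x T\<close> and
  contains \<open>i\<close>, which has been removed.\<close>

lemma aff_independent_exchange:
  assumes fin: "finite B" and ind: "aff_independent B" and T: "T \<subseteq> B"
    and dep: "dependency (insert x T)" and i: "i \<in> T" and x: "x \<notin> B"
  shows "aff_independent (insert x (B - {i}))"
proof -
  have none: "E = {}" if "E \<subseteq> B" "dependency E" for E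
    using aff_independent_iff_dependency[OF fin] ind that by blast
  have "E = {}" if E: "E \<subseteq> insert x (B - {i})" "dependency E" for E
  proof (cases "x \<in> E")
    case True
    have "sym_diff E (insert x T) = {}"
      using none[of "sym_diff E (insert x T)"] dependency_sym_diff[OF E(2) dep] E(1) T True by blast
    then show ?thesis using E(1) i x T by blast
  next
    case False
    then show ?thesis using none[of E] E by blast
  qed
  then show ?thesis using aff_independent_iff_dependency[of "insert x (B - {i})"] fin by blast
qed

text \<open>Steinitz exchange: \<open>x\<close> and \<open>i\<close> lie on the same dependency, so
  adding the one and dropping the other both preserve the affine span.\<close>

lemma is_basis_exchange:
  assumes fin: "finite C" and B: "is_basis B C" and T: "T \<subseteq> B"
    and dep: "dependency (insert x T)" and i: "i \<in> T" and x: "x \<in> C - B"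
  shows "is_basis (insert x (B - {i})) C"
proof -
  have BC: "B \<subseteq> C" and ind: "aff_independent B" and aff: "aff B = aff C"
    using B by (auto simp: is_basis_def)
  have "aff (insert x (B - {i})) = aff (insert x B - {i})"
    using i T x by (auto simp: insert_Diff_if)
  also have "\<dots> = aff (insert x B)"
    using dep T i by (intro aff_remove_dependent[of "insert x T"]) auto
  also have "\<dots> = aff (insert x B - {x})"
    using dep T by (intro aff_remove_dependent[of "insert x T", symmetric]) auto
  also have "\<dots> = aff C" using x aff by simp
  finally show ?thesis
    using aff_independent_exchange[OF finite_subset[OF BC fin] ind T dep i] x BC
    by (auto simp: is_basis_def)
qed

lemma basis_rep_eqI:
  assumes "aff_independent B" "T \<subseteq> B" "odd (card T)" "\<Sum>T = x"
  shows "basis_rep B x = T"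
proof -
  have "x \<in> aff B" using assms unfolding aff_def by blast
  then show ?thesis
    unfolding basis_rep_def using ex1_basis_rep[OF assms(1)] assms by (intro the1_equality) auto
qed

lemma basis_rep_dependency:
  assumes "is_basis B C" "x \<in> C - B"
  shows "basis_rep B x \<subseteq> B" "dependency (insert x (basis_rep B x))"
proof -
  have "x = \<Sum>{x}" "odd (card {x})" "{x} \<subseteq> C" using assms by auto
  then have "x \<in> aff B" using assms(1) unfolding is_basis_def aff_def by blast
  then have T: "basis_rep B x \<subseteq> B \<and> odd (card (basis_rep B x)) \<and> \<Sum>(basis_rep B x) = x"
    unfolding basis_rep_def
    by (rule theI'[OF ex1_basis_rep[rotated]]) (use assms(1) in \<open>simp add: is_basis_def\<close>)
  then show "basis_rep B x \<subseteq> B" by blast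
  have "finite (basis_rep B x)" using T by (auto intro: card_ge_0_finite odd_pos)
  then show "dependency (insert x (basis_rep B x))"
    using T assms(2) dependency_insert_iff[of "basis_rep B x" x] by blast
qed

text \<open>Representations are unique, so any dependency whose only element outside the basis is
  \<open>x\<close> reveals the representation of \<open>x\<close>.\<close>

lemma basis_rep_eq_Diff_dependency:
  assumes "is_basis B C" "dependency E" "x \<in> E" "E - {x} \<subseteq> B"
  shows "basis_rep B x = E - {x}"
proof (rule basis_rep_eqI)
  show "aff_independent B" using assms(1) by (simp add: is_basis_def)
  show "odd (card (E - {x}))" "\<Sum>(E - {x}) = x"
    using dependency_insert_iff[of "E - {x}" x] assms(2,3)
    by (simp_all add: dependency_def insert_absorb)
qed (fact assms(4))

theorem theorem5p3:
  fixes C :: "(bit ^ 'n) set"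
  assumes "k_cap 10 C"
    and "affine_dimension C = 7"
    and "\<exists>B. is_basis B C \<and> has_extended_type C B 7 5 4"
  shows "\<exists>B. is_basis B C \<and> has_extended_type C B 5 5 2"
proof -
  have finC: "finite C" using assms(1) by (auto simp: k_cap_def intro: card_ge_0_finite)
  obtain B x1 x2 where B: "is_basis B C" and ne: "x1 \<noteq> x2" and D: "C - B = {x1, x2}"
    and card1: "card (basis_rep B x1) = 7" and card2: "card (basis_rep B x2) = 5"
    and card12: "card (basis_rep B x1 \<inter> basis_rep B x2) = 4"
    using assms(3) unfolding has_extended_type_def by blast
  define T1 T2 where "T1 = basis_rep B x1" and "T2 = basis_rep B x2"
  have x: "x1 \<in> C - B" "x2 \<in> C - B" using D by auto
  have BC: "B \<subseteq> C" using B by (simp add: is_basis_def)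
  have T: "T1 \<subseteq> B" "dependency (insert x1 T1)" "T2 \<subseteq> B" "dependency (insert x2 T2)"
    using basis_rep_dependency[OF B] x by (auto simp: T1_def T2_def)
  have fin: "finite T1" "finite T2" using T by (auto simp: dependency_def)
  have "card (T1 - T2) = 3" "card (T2 - T1) = 1"
    using card1 card2 card12 fin card_Diff_subset_Int[of T1 T2] card_Diff_subset_Int[of T2 T1]
    by (auto simp: T1_def T2_def Int_commute)
  then obtain q where P: "card (T1 - T2) = 3" and q: "T2 - T1 = {q}"
    by (auto simp: card_1_singleton_iff)
  have "T1 \<inter> T2 \<noteq> {}" using card12 by (auto simp: T1_def T2_def)
  then obtain i where i: "i \<in> T1" "i \<in> T2" by blast
  define B' where "B' = insert x2 (B - {i})"
  have B': "is_basis B' C"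
    unfolding B'_def using is_basis_exchange[OF finC B T(3,4) i(2) x(2)] .
  have notin: "x1 \<notin> B" "x2 \<notin> B" "x1 \<notin> T1" "x1 \<notin> T2" "x2 \<notin> T1" "x2 \<notin> T2" using x T by auto
  \<comment> \<open>The old dependency of \<open>x2\<close> is now solved for \<open>i\<close>,
    which takes the place of \<open>x2\<close> as a dependent point.\<close>
  have rep_i: "basis_rep B' i = insert x2 (T2 - {i})"
  proof -
    have "basis_rep B' i = insert x2 T2 - {i}"
      by (rule basis_rep_eq_Diff_dependency[OF B' T(4)]) (use i T in \<open>auto simp: B'_def\<close>)
    then show ?thesis using i notin by auto
  qed
  have rep_x1: "basis_rep B' x1 = insert x2 (insert q (T1 - T2))"
  proof -
    have E: "sym_diff (insert x1 T1) (insert x2 T2) = insert x1 (insert x2 (insert q (T1 - T2)))"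
      using q ne notin by blast
    \<comment> \<open>Since \<open>i\<close> lies in both \<open>T1\<close> and \<open>T2\<close>,
      it cancels in the sum of the dependencies, so everything except \<open>x1\<close> lies in
      \<open>B'\<close>.\<close>
    have "basis_rep B' x1 = insert x1 (insert x2 (insert q (T1 - T2))) - {x1}"
      by (rule basis_rep_eq_Diff_dependency[OF B' dependency_sym_diff[OF T(2,4), unfolded E]])
        (use i T q in \<open>auto simp: B'_def\<close>)
    then show ?thesis using ne q notin by auto
  qed
  have q': "q \<in> T2" "q \<notin> T1" using q by auto
  have "card (basis_rep B' i) = 5"
    using fin notin i card2 by (simp add: rep_i T2_def[symmetric])
  moreover have "card (basis_rep B' x1) = 5"
    using fin notin q' P by (auto simp: rep_x1 card_insert_if)
  \<comment> \<open>Apart from \<open>x2\<close>, only \<open>q\<close> is common, because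
    \<open>T1 - T2\<close> avoids \<open>T2\<close>. It survives the removal of \<open>i\<close>
    because \<open>i\<close> is in \<open>T1\<close> and \<open>q\<close> is not.\<close>
  moreover have "basis_rep B' i \<inter> basis_rep B' x1 = {x2, q}"
    using rep_i rep_x1 q' i by auto
  then have "card (basis_rep B' i \<inter> basis_rep B' x1) = 2"
    using q' notin by (metis card_2_iff)
  moreover have "C - B' = {i, x1}" "i \<noteq> x1"
    using D BC T i ne notin by (auto simp: B'_def)
  ultimately have "has_extended_type C B' 5 5 2"
    unfolding has_extended_type_def by blast
  then show ?thesis using B' by blast
qed

end
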